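(* Let $k\ge 0$ be an integer. The number of classes of upper $k$-gap balancing numbers is at most $\max\{1,k\}$.
   Context: Let $k\ge 0$ be an integer and $T(i)=\frac{i(i+1)}{2}$. An integer $B\ge k$ is an upper $k$-gap balancing number if there is an integer $r\ge 0$ with $1+2+\dots+(B-k)=(B+1)+\dots+(B+r)$ (empty sums are $0$), equivalently $T(B-k)+T(B)=T(B+r)$. (By convention $k$ is the smallest upper $k$-gap balancing number; in particular $0$ is an upper $0$-gap balancing number.) The upper $k$-gap Lucas-balancing number of $B$ is $C=\sqrt{8B^2+8(1-k)B+(2k-1)^2}$ (nonnegative square root), and $(B,C)$ is called an upper $k$-gap balancing pair. A class of upper $k$-gap balancing pairs (or numbers) is a sequence $((B_i,C_i))_{i\ge 0}$ where $(B_0,C_0)$ is an upper $k$-gap balancing pair with $k\le B_0<4k+2$ and $B_{i+1}=3B_i+C_i+1-k$, $C_{i+1}=8B_i+3C_i+4-4k$ for $i\ge 0$. *)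

theory Defs
  imports Complex_Main
begin

definition upper_gap_balancing :: "nat \<Rightarrow> int \<Rightarrow> bool" where
  "upper_gap_balancing k B \<longleftrightarrow>
     B \<ge> int k \<and> (\<exists>r\<ge>0. (\<Sum>i = 1..B - int k. i) = (\<Sum>i = B + 1..B + r. i))"

definition upper_gap_lucas :: "nat \<Rightarrow> int \<Rightarrow> real" where
  "upper_gap_lucas k B =
     sqrt (8 * (real_of_int B)^2 + 8 * (1 - real k) * real_of_int B + (2 * real k - 1)^2)"

text \<open>The second component is taken to be an integer; lemma \<open>upper_gap_lucas_integer\<close>
  below shows that this excludes no upper gap balancing number.\<close>

definition upper_gap_balancing_pair :: "nat \<Rightarrow> int \<times> int \<Rightarrow> bool" where
  "upper_gap_balancing_pair k p \<longleftrightarrow>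
     upper_gap_balancing k (fst p) \<and> real_of_int (snd p) = upper_gap_lucas k (fst p)"

definition upper_gap_step :: "nat \<Rightarrow> int \<times> int \<Rightarrow> int \<times> int" where
  "upper_gap_step k = (\<lambda>(B, C). (3 * B + C + 1 - int k, 8 * B + 3 * C + 4 - 4 * int k))"

text \<open>A class is a sequence of pairs, so two classes are equal iff they agree at every index.\<close>

definition upper_gap_classes :: "nat \<Rightarrow> (nat \<Rightarrow> int \<times> int) set" where
  "upper_gap_classes k =
     {s. upper_gap_balancing_pair k (s 0) \<and>
         int k \<le> fst (s 0) \<and> fst (s 0) < 4 * int k + 2 \<and>
         (\<forall>i. s (Suc i) = upper_gap_step k (s i))}"

lemma double_sum_int_atLeastAtMost:
  fixes a b :: int
  assumes "a \<le> b + 1"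
  shows "2 * (\<Sum>i = a..b. i) = b * (b + 1) - a * (a - 1)"
proof -
  have "2 * (\<Sum>i = a..a + int n - 1. i) = (a + int n - 1) * (a + int n) - a * (a - 1)" for n
  proof (induction n)
    case 0
    then show ?case by (simp add: algebra_simps)
  next
    case (Suc n)
    have "{a..a + int (Suc n) - 1} = insert (a + int n) {a..a + int n - 1}" by auto
    then show ?case using Suc by (simp add: algebra_simps)
  qed
  from this[of "nat (b + 1 - a)"] assms show ?thesis by (simp add: algebra_simps)
qed

lemma upper_gap_lucas_integer:
  assumes "upper_gap_balancing k B"
  shows "\<exists>C. upper_gap_balancing_pair k (B, C)"
proof -
  from assms obtain r where B: "B \<ge> int k" and r: "r \<ge> 0"
    and eq: "(\<Sum>i = 1..B - int k. i) = (\<Sum>i = B + 1..B + r. i)"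
    unfolding upper_gap_balancing_def by blast
  let ?C = "2 * (B + r) + 1"
  have "(B - int k) * (B - int k + 1) = (B + r) * (B + r + 1) - (B + 1) * B"
    using double_sum_int_atLeastAtMost[of 1 "B - int k"]
      double_sum_int_atLeastAtMost[of "B + 1" "B + r"] B r eq by simp
  then have "8 * B^2 + 8 * (1 - int k) * B + (2 * int k - 1)^2 = ?C^2"
    by (simp add: algebra_simps power2_eq_square)
  then have "real_of_int (8 * B^2 + 8 * (1 - int k) * B + (2 * int k - 1)^2)
      = (real_of_int ?C)^2"
    by (metis of_int_power)
  then have "8 * (real_of_int B)^2 + 8 * (1 - real k) * real_of_int B + (2 * real k - 1)^2
      = (real_of_int ?C)^2"
    by simp
  then have "upper_gap_lucas k B = \<bar>real_of_int ?C\<bar>"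
    unfolding upper_gap_lucas_def by (metis real_sqrt_abs)
  then have "upper_gap_lucas k B = real_of_int ?C" using B r by simp
  then show ?thesis using assms unfolding upper_gap_balancing_pair_def
    by (intro exI[of _ ?C]) simp
qed

end

theory Submission
  imports Defs
begin

text \<open>
  A class is the orbit of its first pair, and the second component of that pair is a square root
  determined by the first, so classes are counted by the upper gap balancing numbers \<open>B\<close>
  with \<open>k \<le> B < 4k + 2\<close>.

  Such a \<open>B\<close> is recovered from its witness \<open>r\<close>, the number of terms in the right-hand sum. With
  \<open>m = B - k - r\<close> the equation \<open>T(B - k) + T(B) = T(B + r)\<close> becomes \<open>T(m) = r(r + k)\<close>, and
  \<open>B \<ge> k\<close> forces \<open>m \<ge> 0\<close>. Since \<open>T\<close> is injective on nonnegative integers, \<open>r\<close> determines \<open>m\<close>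
  and hence \<open>B = k + r + m\<close>.

  It remains to bound \<open>r\<close>. If \<open>r > k\<close>, then \<open>B < 4k + 2\<close> leaves \<open>m \<le> 2k\<close>, which is too small
  for \<open>T(m) = r(r + k)\<close>; and \<open>r = k\<close> would require \<open>m(m + 1) = (2k)\<^sup>2\<close>, impossible for
  \<open>k \<ge> 1\<close> because \<open>(2k)\<^sup>2\<close> lies strictly between two consecutive products \<open>m(m + 1)\<close>. So \<open>r\<close> takes
  at most the values \<open>0, \<dots>, k - 1\<close>, or only the value \<open>0\<close> when \<open>k = 0\<close>.
\<close>

lemma pronic_strict_mono:
  fixes m n :: int
  assumes "0 \<le> m" "m < n"
  shows "m * (m + 1) < n * (n + 1)"
  using assms by (intro mult_strict_mono) auto

text \<open>The change of variables \<open>B = k + r + m\<close> turns the balancing equation into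
  \<open>T(m) = r(r + k)\<close>, whose two roots have the form \<open>m\<close> and \<open>-1 - m\<close>. If \<open>m\<close> were the
  negative one, then \<open>B \<ge> k\<close> would give \<open>0 \<le> -1 - m \<le> r - 1\<close>, hence \<open>m(m + 1) \<le> (r - 1)r\<close>,
  which is less than \<open>2r(r + k)\<close>.\<close>

lemma upper_gap_balancing_obtain:
  assumes "upper_gap_balancing k B"
  obtains r m where "r \<ge> 0" "m \<ge> 0" "B = int k + r + m" "m * (m + 1) = 2 * r * (r + int k)"
proof -
  from assms obtain r where B: "B \<ge> int k" and r: "r \<ge> 0"
    and eq: "(\<Sum>i = 1..B - int k. i) = (\<Sum>i = B + 1..B + r. i)"
    unfolding upper_gap_balancing_def by blast
  define m where "m = B - int k - r"
  have Bm: "B = int k + r + m" by (simp add: m_def)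
  have "(B - int k) * (B - int k + 1) = (B + r) * (B + r + 1) - (B + 1) * B"
    using double_sum_int_atLeastAtMost[of 1 "B - int k"]
      double_sum_int_atLeastAtMost[of "B + 1" "B + r"] B r eq by simp
  then have pronic: "m * (m + 1) = 2 * r * (r + int k)"
    unfolding Bm by (simp add: algebra_simps)
  have "m \<ge> 0"
  proof (rule ccontr)
    assume "\<not> m \<ge> 0"
    then have n: "0 \<le> - 1 - m" "- 1 - m < r" using B Bm by auto
    have "m * (m + 1) < r * (r + 1)"
      using pronic_strict_mono[OF n] by (simp add: algebra_simps)
    moreover have "r * (r + 1) \<le> 2 * r * (r + int k)"
    proof -
      have "r * (r + 1) \<le> r * (2 * (r + int k))"
        using n r by (intro mult_left_mono) auto
      then show ?thesis by (simp add: algebra_simps)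
    qed
    ultimately show False using pronic by simp
  qed
  with r Bm pronic that show thesis by blast
qed

lemma pronic_neq_square_double:
  fixes k m :: int
  assumes "k \<ge> 1" "m \<ge> 0"
  shows "m * (m + 1) \<noteq> (2 * k) * (2 * k)"
proof (cases "m < 2 * k")
  case True
  then have "m * (m + 1) \<le> m * (2 * k)" using assms by (intro mult_left_mono) auto
  also have "\<dots> < (2 * k) * (2 * k)" using True assms by (intro mult_strict_right_mono) auto
  finally show ?thesis by simp
next
  case False
  then have "(2 * k) * (2 * k) < (2 * k) * (m + 1)" using assms
    by (intro mult_strict_left_mono) auto
  also have "\<dots> \<le> m * (m + 1)" using False assms by (intro mult_right_mono) auto
  finally show ?thesis by simp
qed

text \<open>The bound \<open>B < 4k + 2\<close> is exactly what confines \<open>r\<close> to \<open>0, \<dots>, k\<close>: the step map sends the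
  pair \<open>(k, 2k + 1)\<close>, where \<open>r = 0\<close>, to one with first component \<open>4k + 2\<close> and \<open>r = k + 1\<close>.
  The value \<open>r = k\<close> is then lost for arithmetic reasons.\<close>

lemma gap_length_less:
  fixes k r m :: int
  assumes "k \<ge> 0" "r \<ge> 0" "m \<ge> 0"
    and pronic: "m * (m + 1) = 2 * r * (r + k)"
    and bound: "k + r + m < 4 * k + 2"
  shows "r < max 1 k"
proof -
  have "r \<le> k"
  proof (rule ccontr)
    assume "\<not> r \<le> k"
    then have r: "k + 1 \<le> r" and m: "m \<le> 2 * k" using bound by auto
    have "m * (m + 1) \<le> (2 * k) * (2 * k + 1)"
      using m assms by (intro mult_mono) auto
    also have "\<dots> < (2 * (k + 1)) * (2 * k + 1)"
      using assms by (intro mult_strict_right_mono) auto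
    also have "\<dots> \<le> (2 * r) * (r + k)"
      using r assms by (intro mult_mono) auto
    finally show False using pronic by simp
  qed
  moreover have "r \<noteq> k" if "k \<ge> 1"
    using pronic_neq_square_double[OF that \<open>m \<ge> 0\<close>] pronic by auto
  ultimately show ?thesis by force
qed

lemma card_upper_gap_balancing_le:
  fixes k :: nat
  defines "S \<equiv> {B. upper_gap_balancing k B \<and> B < 4 * int k + 2}"
  shows "finite S \<and> card S \<le> max 1 k"
proof -
  define P where "P B r m \<longleftrightarrow> m \<ge> 0 \<and> B = int k + r + m \<and> m * (m + 1) = 2 * r * (r + int k)"
    for B r m :: int
  let ?R = "{0..<max 1 (int k)}"
  have "\<exists>r. r \<in> ?R \<and> (\<exists>m. P B r m)" if "B \<in> S" for B
  proof -
    have B: "upper_gap_balancing k B" "B < 4 * int k + 2" using that by (auto simp: S_def)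
    obtain r m where rm: "r \<ge> 0" "m \<ge> 0" "B = int k + r + m"
        "m * (m + 1) = 2 * r * (r + int k)"
      using upper_gap_balancing_obtain[OF B(1)] .
    have "r < max 1 (int k)"
      using gap_length_less[of "int k" r m] rm B(2) by simp
    with rm show ?thesis unfolding P_def by auto
  qed
  then obtain f where f: "\<And>B. B \<in> S \<Longrightarrow> f B \<in> ?R \<and> (\<exists>m. P B (f B) m)"
    by metis
  have "inj_on f S"
  proof (rule inj_onI)
    fix B B' assume "B \<in> S" "B' \<in> S" and same: "f B = f B'"
    then obtain m m' where mm: "P B (f B) m" "P B' (f B) m'" using f by metis
    then have "m * (m + 1) = m' * (m' + 1)" "m \<ge> 0" "m' \<ge> 0" by (auto simp: P_def)
    then have "m = m'"
      using pronic_strict_mono[of m m'] pronic_strict_mono[of m' m] by linarith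
    with mm show "B = B'" by (simp add: P_def)
  qed
  moreover have "f ` S \<subseteq> ?R" using f by blast
  ultimately have "finite S" "card S \<le> card ?R"
    using inj_on_finite[of f S ?R] card_inj_on_le[of f S ?R] by auto
  moreover have "card ?R = max 1 k" by (simp add: max_def)
  ultimately show ?thesis by simp
qed

lemma upper_gap_class_eqI:
  assumes s: "s \<in> upper_gap_classes k" and t: "t \<in> upper_gap_classes k"
    and start: "fst (s 0) = fst (t 0)"
  shows "s = t"
proof
  fix i
  show "s i = t i"
  proof (induction i)
    case 0
    have "real_of_int (snd (s 0)) = real_of_int (snd (t 0))"
      using s t start by (simp add: upper_gap_classes_def upper_gap_balancing_pair_def)
    with start show ?case by (simp add: prod_eq_iff)
  next
    case (Suc i)
    then show ?case using s t by (simp add: upper_gap_classes_def)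
  qed
qed

theorem theorem4p5:
  fixes k :: nat
  shows "finite (upper_gap_classes k) \<and> card (upper_gap_classes k) \<le> max 1 k"
proof -
  let ?S = "{B. upper_gap_balancing k B \<and> B < 4 * int k + 2}"
  let ?start = "\<lambda>s :: nat \<Rightarrow> int \<times> int. fst (s 0)"
  have inj: "inj_on ?start (upper_gap_classes k)"
    by (rule inj_onI) (rule upper_gap_class_eqI)
  have sub: "?start ` upper_gap_classes k \<subseteq> ?S"
    by (auto simp: upper_gap_classes_def upper_gap_balancing_pair_def)
  have S: "finite ?S" "card ?S \<le> max 1 k"
    using card_upper_gap_balancing_le[of k] by auto
  have "finite (upper_gap_classes k)" using inj_on_finite[OF inj sub S(1)] .
  moreover have "card (upper_gap_classes k) \<le> card ?S" using card_inj_on_le[OF inj sub S(1)] .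
  ultimately show ?thesis using S(2) by linarith
qed

end
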